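(* Let $f\colon\mathbb{R}_+\to\mathbb{R}$ be a twice continuously differentiable function with nowhere vanishing first and second derivatives such that $f'/f''$ is convex and negative, and put $\kappa_f(x):=\frac{xf''(x)}{f'(x)}+1$ for $x>0$. Then $\kappa_f$ is a decreasing function. Furthermore, the following assertions are equivalent: (i) $\mathscr{A}_f$ is a Hardy mean; (ii) there exists a parameter $q<1$ such that $\mathscr{A}_f\le\mathscr{P}_q$; (iii) $p:=\lim_{x\to0^+}\kappa_f(x)<1$. And, whenever one (equivalently, each) of the assertions (i), (ii), (iii) holds, $\mathscr{A}_f\le\mathscr{P}_p$ and $\mathscr{H}(\mathscr{A}_f)=C(p)$.
   Context: $\mathbb{R}_+=(0,\infty)$; "decreasing" is meant in the non-strict sense. For $p\in[-\infty,+\infty]$, $$C(p):=\begin{cases}1 & p=-\infty,\\ (1-p)^{-1/p} & p\in(-\infty,0)\cup(0,1),\\ e & p=0,\\ +\infty & p\in[1,\infty].\end{cases}$$ For a continuous, strictly monotone $f\colon\mathbb{R}_+\to\mathbb{R}$, the quasi-arithmetic mean $\mathscr{A}_f\colon\bigcup_{n=1}^\infty\mathbb{R}_+^n\to\mathbb{R}_+$ is $$\mathscr{A}_f(x_1,\dots,x_n):=f^{-1}\left(\frac{f(x_1)+\cdots+f(x_n)}{n}\right).$$ For $p\in\mathbb{R}$, $\mathscr{P}_p$ denotes the $p$-th power mean on $\mathbb{R}_+$: $\mathscr{P}_p(x_1,\dots,x_n)=\left(\frac{x_1^p+\cdots+x_n^p}{n}\right)^{1/p}$ if $p\ne0$ and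 $\mathscr{P}_0(x_1,\dots,x_n)=(x_1\cdots x_n)^{1/n}$. For means $M,N$ on $\mathbb{R}_+$, $M\le N$ means $M(x)\le N(x)$ for all $n\in\mathbb{N}$ and all $x\in\mathbb{R}_+^n$. For a mean $M\colon\bigcup_{n=1}^\infty\mathbb{R}_+^n\to\mathbb{R}_+$, the Hardy constant $\mathscr{H}(M)$ is the smallest nonnegative extended real number such that $$\sum_{n=1}^\infty M(x_1,\dots,x_n)\le\mathscr{H}(M)\sum_{n=1}^\infty x_n$$ for all sequences $(x_n)_{n=1}^\infty$ in $\mathbb{R}_+$; $M$ is called a Hardy mean if $\mathscr{H}(M)$ is finite. *)

theory Defs
  imports "HOL-Analysis.Analysis"
begin

text \<open>
  A mean on the positive reals has type \<open>real list \<Rightarrow> real\<close>; the tuples are the nonempty lists of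
  positive reals, and values on other lists carry no meaning.
\<close>

definition positive_tuple :: "real list \<Rightarrow> bool" where
  "positive_tuple xs \<longleftrightarrow> xs \<noteq> [] \<and> (\<forall>x\<in>set xs. 0 < x)"

definition mean_le :: "(real list \<Rightarrow> real) \<Rightarrow> (real list \<Rightarrow> real) \<Rightarrow> bool" where
  "mean_le M N \<longleftrightarrow> (\<forall>xs. positive_tuple xs \<longrightarrow> M xs \<le> N xs)"

definition quasi_arithmetic_mean :: "(real \<Rightarrow> real) \<Rightarrow> real list \<Rightarrow> real" where
  "quasi_arithmetic_mean f xs = inv_into {0<..} f ((\<Sum>x\<leftarrow>xs. f x) / real (length xs))"

definition power_mean :: "real \<Rightarrow> real list \<Rightarrow> real" where
  "power_mean p xs =
     (if p = 0 then prod_list xs powr (1 / real (length xs))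
      else ((\<Sum>x\<leftarrow>xs. x powr p) / real (length xs)) powr (1 / p))"

text \<open>
  Sequences are indexed from 0, so the \<open>n\<close>-th summand is the mean of \<open>x 0, \<dots>, x n\<close>. The sums are
  taken in \<^typ>\<open>ennreal\<close> and may be infinite.
\<close>

definition hardy_bound :: "(real list \<Rightarrow> real) \<Rightarrow> ennreal \<Rightarrow> bool" where
  "hardy_bound M C \<longleftrightarrow>
     (\<forall>x :: nat \<Rightarrow> real. (\<forall>n. 0 < x n) \<longrightarrow>
        (\<Sum>n. ennreal (M (map x [0..<Suc n]))) \<le> C * (\<Sum>n. ennreal (x n)))"

definition hardy_constant :: "(real list \<Rightarrow> real) \<Rightarrow> ennreal" where
  "hardy_constant M = Inf {C. hardy_bound M C}"

definition hardy_mean :: "(real list \<Rightarrow> real) \<Rightarrow> bool" where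
  "hardy_mean M \<longleftrightarrow> hardy_constant M < \<infinity>"

text \<open>For a mean with positive values, the infimum is attained, so it is the smallest bound.\<close>

lemma hardy_constant_is_least:
  assumes pos: "\<And>xs. positive_tuple xs \<Longrightarrow> 0 < M xs"
  shows "hardy_bound M (hardy_constant M)"
    and "hardy_bound M C \<Longrightarrow> hardy_constant M \<le> C"
proof -
  let ?H = "hardy_constant M"
  have fin: "(\<Sum>n. ennreal (M (map x [0..<Suc n]))) \<le> ?H * (\<Sum>n. ennreal (x n))"
    if x: "\<forall>n. 0 < x n" and s: "(\<Sum>n. ennreal (x n)) \<noteq> \<infinity>" for x :: "nat \<Rightarrow> real"
  proof -
    let ?S = "\<Sum>n. ennreal (x n)" and ?A = "\<Sum>n. ennreal (M (map x [0..<Suc n]))"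
    have S0: "?S \<noteq> 0"
      using x by (metis ennreal_eq_0_iff linorder_not_le suminf_eq_zero_iff summableI zero_le)
    have "?A / ?S \<le> C" if "hardy_bound M C" for C
      using that x S0 s unfolding hardy_bound_def
      by (metis divide_le_posI_ennreal mult.commute not_gr_zero)
    then have "?A / ?S \<le> ?H"
      unfolding hardy_constant_def by (intro Inf_greatest) simp
    then have "?A / ?S * ?S \<le> ?H * ?S"
      by (rule mult_right_mono) simp
    then show ?thesis
      using S0 s by (simp add: ennreal_divide_times ennreal_times_divide mult_divide_eq_ennreal)
  qed
  have "?H \<noteq> 0"
  proof
    assume H0: "?H = 0"
    let ?x = "\<lambda>n. (1/2 :: real) ^ n"
    have "(\<Sum>n. ennreal (?x n)) \<noteq> \<infinity>"
      by (subst suminf_ennreal2) (auto intro: summable_geometric)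
    then have "(\<Sum>n. ennreal (M (map ?x [0..<Suc n]))) = 0"
      using fin[of ?x] H0 by simp
    then have "ennreal (M (map ?x [0..<Suc 0])) = 0"
      by (metis (no_types, lifting) suminf_eq_zero_iff summableI zero_le)
    moreover have "0 < M (map ?x [0..<Suc 0])"
      by (rule pos) (simp add: positive_tuple_def)
    ultimately show False
      by (simp add: ennreal_eq_0_iff)
  qed
  then show "hardy_bound M ?H"
    using fin unfolding hardy_bound_def by (metis ennreal_mult_top infinity_ennreal_def top_greatest)
  show "hardy_bound M C \<Longrightarrow> ?H \<le> C"
    unfolding hardy_constant_def by (rule Inf_lower) simp
qed

definition hardy_C :: "ereal \<Rightarrow> ennreal" where
  "hardy_C p =
     (if p = -\<infinity> then 1
      else if p = 0 then ennreal (exp 1)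
      else if p < 1 then ennreal ((1 - real_of_ereal p) powr (- 1 / real_of_ereal p))
      else \<infinity>)"

definition kappa :: "(real \<Rightarrow> real) \<Rightarrow> real \<Rightarrow> real" where
  "kappa f x = x * deriv (deriv f) x / deriv f x + 1"

end

theory Submission
  imports Defs
begin

text \<open>
  Everything is measured against one increasing function per exponent: the normalised power
  \<open>box_cox q x = (x^q - 1) / q\<close>, which at \<open>q = 0\<close> is the logarithm. It is concave for
  \<open>q < 1\<close>, it generates the power mean \<open>P_q\<close>, its derivative is \<open>x^(q - 1)\<close> for all \<open>q\<close> alike,
  and the Hardy constant \<open>C q\<close> is singled out by \<open>box_cox q (1 / C q) = - 1\<close>. Hence positive, zero
  and negative exponents need no separate treatment.

  \<^emph>\<open>Monotonicity and limit.\<close> With \<open>g = f' / f''\<close> one has \<open>kappa f x = x / g x + 1\<close>. As \<open>g\<close> is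
  convex and negative, \<open>- g x / x\<close> decreases in \<open>x\<close>, hence so does \<open>kappa f\<close>; it stays below \<open>1\<close>,
  so its limit \<open>p\<close> at \<open>0\<close> is its supremum and \<open>p \<le> 1\<close>.

  \<^emph>\<open>Comparison.\<close> The quotient \<open>f' x / x^(q - 1)\<close> has the derivative
  \<open>(kappa f x - q) x^(- q) f' x\<close>. If \<open>f\<close> is increasing, as may be assumed because \<open>f\<close> and
  \<open>- f\<close> generate the same mean, this quotient is therefore decreasing wherever \<open>kappa f \<le> q\<close>; then \<open>f\<close> is a concave function of \<open>box_cox q\<close>, and
  Jensen's inequality gives \<open>A_f \<le> P_q\<close> (\<open>sum_le_at_power_mean\<close>). With \<open>q = p\<close> this holds on all of
  the half-line. The reverse inequality \<open>P_q \<le> A_f\<close> holds for \<open>q < p\<close> on tuples with entries close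
  to \<open>0\<close>, because there \<open>kappa f\<close> exceeds \<open>q\<close>.

  \<^emph>\<open>Upper bound.\<close> For \<open>q < 1\<close> the inequality of Hardy, Carleman and Knopp, with constant \<open>C q\<close>,
  follows from a telescoping estimate between consecutive means (\<open>hardy_step\<close>), which results from
  the tangents to \<open>box_cox q\<close> at two points.

  \<^emph>\<open>Lower bound.\<close> For \<open>q < 1\<close> there is a sequence, with entries as small as desired, whose power
  means are exactly \<open>a / n\<close> while its \<open>n\<close>-th entry is asymptotic to \<open>a / (n C q)\<close>. Divergence of the
  harmonic series forces every Hardy bound of a mean that dominates \<open>P_q\<close> near \<open>0\<close> to be at least
  \<open>C q\<close> (\<open>hardy_bound_ge\<close>). Applied to \<open>A_f\<close> for \<open>q\<close> tending to \<open>p\<close> from below, this says that a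
  bound \<open>d\<close> satisfies \<open>1 \<le> d c\<close> whenever \<open>- 1 < box_cox p c\<close>. If \<open>p < 1\<close> this means
  \<open>C p \<le> d\<close>; if \<open>p = 1\<close> it holds for all \<open>c > 0\<close>, so no finite bound exists. Hence (i) implies (iii);
  (iii) implies (ii) by the comparison, and (ii) implies (i) by the upper bound for \<open>P_q\<close>.
\<close>

section \<open>The generating functions of the power means\<close>

definition box_cox :: "real \<Rightarrow> real \<Rightarrow> real" where
  "box_cox q x = (if q = 0 then ln x else (x powr q - 1) / q)"

lemma box_cox_one [simp]: "box_cox q 1 = 0"
  by (simp add: box_cox_def)

lemma has_derivative_box_cox:
  assumes "0 < x"
  shows "(box_cox q has_real_derivative x powr (q - 1)) (at x)"
proof (cases "q = 0")
  case True
  then have "box_cox q = ln" by (auto simp: box_cox_def fun_eq_iff)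
  then show ?thesis
    using assms True by (auto intro!: derivative_eq_intros simp: powr_minus divide_inverse)
next
  case False
  then have "box_cox q = (\<lambda>x. (x powr q - 1) / q)" by (auto simp: box_cox_def fun_eq_iff)
  then show ?thesis
    using assms False by (auto intro!: derivative_eq_intros)
qed

lemma box_cox_mult:
  assumes "0 < r" "0 < u"
  shows "box_cox q (r * u) = u powr q * box_cox q r + box_cox q u"
  using assms by (simp add: box_cox_def ln_mult powr_mult field_simps)

lemma box_cox_strict_mono:
  assumes "0 < x" "x < y"
  shows "box_cox q x < box_cox q y"
proof (rule DERIV_pos_imp_increasing[OF assms(2)])
  fix t assume "x \<le> t" "t \<le> y"
  with assms have "0 < t" by simp
  then show "\<exists>D. (box_cox q has_real_derivative D) (at t) \<and> 0 < D"
    using has_derivative_box_cox[of t q] by auto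
qed

lemma box_cox_less_iff:
  assumes "0 < x" "0 < y"
  shows "box_cox q x < box_cox q y \<longleftrightarrow> x < y"
  using assms box_cox_strict_mono by (metis linorder_less_linear order_less_asym)

lemma isCont_box_cox: "0 < x \<Longrightarrow> isCont (box_cox q) x"
  using has_derivative_box_cox DERIV_isCont by blast

text \<open>
  The limit passage from exponents below \<open>p\<close> to \<open>p\<close> itself. At \<open>p = 0\<close> the quotient defining
  \<open>box_cox\<close> is the difference quotient of \<open>c^q\<close> at \<open>0\<close>.
\<close>

lemma tendsto_box_cox_exponent:
  assumes "0 < c"
  shows "((\<lambda>q. box_cox q c) \<longlongrightarrow> box_cox p c) (at_left p)"
proof (cases "p = 0")
  case True
  have "((\<lambda>q. c powr q) has_real_derivative ln c) (at 0)"
    using assms by (auto intro!: derivative_eq_intros)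
  then have "((\<lambda>q. (c powr q - 1) / q) \<longlongrightarrow> ln c) (at 0)"
    using assms by (simp add: has_field_derivative_iff)
  then have "((\<lambda>q. (c powr q - 1) / q) \<longlongrightarrow> ln c) (at_left 0)"
    by (rule tendsto_within_subset) simp
  then have "((\<lambda>q. box_cox q c) \<longlongrightarrow> ln c) (at_left 0)"
    by (rule Lim_transform_eventually)
       (auto simp: box_cox_def eventually_at_filter)
  then show ?thesis using True by (simp add: box_cox_def)
next
  case False
  have "((\<lambda>q. (c powr q - 1) / q) \<longlongrightarrow> (c powr p - 1) / p) (at p)"
    using assms False by (intro tendsto_intros) auto
  moreover have "\<forall>\<^sub>F q in at p. q \<noteq> 0"
    using False by (rule tendsto_imp_eventually_ne[OF tendsto_ident_at])
  then have "\<forall>\<^sub>F q in at p. (c powr q - 1) / q = box_cox q c"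
    by eventually_elim (simp add: box_cox_def)
  ultimately have "((\<lambda>q. box_cox q c) \<longlongrightarrow> (c powr p - 1) / p) (at p)"
    by (rule Lim_transform_eventually)
  then show ?thesis
    using False by (auto simp: box_cox_def intro: tendsto_within_subset)
qed

text \<open>
  If \<open>F' / G' = h\<close> is decreasing, then \<open>F\<close> is a concave function of \<open>G\<close>, and it lies below its
  tangent at \<open>m\<close>, whose slope with respect to \<open>G\<close> is \<open>h m\<close>. Stated in this form, no inverse of \<open>G\<close>
  is involved. It yields both the concavity of \<open>box_cox\<close> and the comparison of means.
\<close>

lemma relative_tangent:
  fixes F G :: "real \<Rightarrow> real"
  assumes S: "is_interval S"
    and F: "\<And>x. x \<in> S \<Longrightarrow> (F has_real_derivative h x * g x) (at x)"
    and G: "\<And>x. x \<in> S \<Longrightarrow> (G has_real_derivative g x) (at x)"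
    and g: "\<And>x. x \<in> S \<Longrightarrow> 0 \<le> g x"
    and h: "antimono_on S h"
    and xm: "x \<in> S" "m \<in> S"
  shows "F x - F m \<le> h m * (G x - G m)"
proof -
  define D where "D = (\<lambda>t. F t - h m * G t)"
  have D: "(D has_real_derivative (h t - h m) * g t) (at t)" if "t \<in> S" for t
    using DERIV_diff[OF F[OF that] DERIV_cmult[OF G[OF that], of "h m"]]
    by (simp add: D_def algebra_simps)
  have "D x \<le> D m"
  proof (cases "x \<le> m")
    case True
    show ?thesis
    proof (rule DERIV_nonneg_imp_nondecreasing[OF True])
      fix t assume t: "x \<le> t" "t \<le> m"
      then have "t \<in> S" using S xm by (meson mem_is_interval_1_I)
      moreover have "h m \<le> h t"
        using h t xm \<open>t \<in> S\<close> by (auto simp: monotone_on_def)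
      ultimately show "\<exists>y. (D has_real_derivative y) (at t) \<and> 0 \<le> y"
        using D[of t] g[of t] by (intro exI[of _ "(h t - h m) * g t"]) simp
    qed
  next
    case False
    then have le: "m \<le> x" by simp
    show ?thesis
    proof (rule DERIV_nonpos_imp_nonincreasing[OF le])
      fix t assume t: "m \<le> t" "t \<le> x"
      then have "t \<in> S" using S xm by (meson mem_is_interval_1_I)
      moreover have "h t \<le> h m"
        using h t xm \<open>t \<in> S\<close> by (auto simp: monotone_on_def)
      ultimately show "\<exists>y. (D has_real_derivative y) (at t) \<and> y \<le> 0"
        using D[of t] g[of t]
        by (intro exI[of _ "(h t - h m) * g t"]) (simp add: mult_nonpos_nonneg)
    qed
  qed
  then show ?thesis by (simp add: D_def algebra_simps)
qed

lemma box_cox_le_tangent: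
  assumes "q < 1" "0 < x" "0 < m"
  shows "box_cox q x - box_cox q m \<le> m powr (q - 1) * (x - m)"
proof (rule relative_tangent[of "{0<..}" "box_cox q" "\<lambda>t. t powr (q - 1)" "\<lambda>_. 1" "\<lambda>t. t"])
  show "antimono_on {0<..} (\<lambda>t::real. t powr (q - 1))"
    using assms by (auto simp: monotone_on_def intro!: powr_mono2')
qed (use assms has_derivative_box_cox in \<open>auto simp: is_interval_def\<close>)

section \<open>The Hardy constant of a power mean\<close>

definition power_hardy_constant :: "real \<Rightarrow> real" where
  "power_hardy_constant q = (if q = 0 then exp 1 else (1 - q) powr (- 1 / q))"

lemma power_hardy_constant_pos: "q < 1 \<Longrightarrow> 0 < power_hardy_constant q"
  by (simp add: power_hardy_constant_def)

lemma hardy_C_eq: "p < 1 \<Longrightarrow> hardy_C (ereal p) = ennreal (power_hardy_constant p)"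
  by (simp add: hardy_C_def power_hardy_constant_def zero_ereal_def one_ereal_def)

lemma power_hardy_constant_powr:
  "q < 1 \<Longrightarrow> power_hardy_constant q powr (- q) = 1 - q"
  by (simp add: power_hardy_constant_def powr_powr)

text \<open>
  This equation is how the constant enters both bounds: in the upper one it cancels the constant
  terms of two tangents, and in the lower one it identifies the limit of the ratio between entry and
  mean along an extremal sequence.
\<close>

lemma box_cox_inverse_power_hardy_constant:
  assumes "q < 1"
  shows "box_cox q (1 / power_hardy_constant q) = - 1"
proof (cases "q = 0")
  case True
  then show ?thesis
    by (simp add: box_cox_def power_hardy_constant_def ln_div)
next
  case False
  have "(1 / power_hardy_constant q) powr q = power_hardy_constant q powr (- q)"
    using power_hardy_constant_pos[OF assms] by (simp add: powr_divide powr_minus_divide)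
  then show ?thesis
    using False power_hardy_constant_powr[OF assms] by (simp add: box_cox_def)
qed

text \<open>
  Here \<open>y\<close> is the mean of the first \<open>j\<close> entries, \<open>x\<close> is the next entry and \<open>m\<close> is the new mean. For
  an extremal sequence, \<open>y\<close> is close to \<open>m\<close> and \<open>x\<close> is close to \<open>m / C\<close>, so concavity is used at
  these two points. The slopes there are \<open>m^(q - 1)\<close> and \<open>m^(q - 1) (1 - q) C\<close>; summing the tangent
  estimates cancels the values of \<open>box_cox\<close>. The term \<open>(j + 1) m - j y\<close> telescopes along a sequence.
\<close>

lemma hardy_step:
  assumes q: "q < 1" and pos: "0 < x" "0 < y" "0 < m" and j: "0 \<le> j"
    and mean: "(j + 1) * box_cox q m = j * box_cox q y + box_cox q x"
  shows "(j + 1) * m + (1 - q) * m \<le> j * y + (1 - q) * power_hardy_constant q * x"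
proof -
  define C where "C = power_hardy_constant q"
  have C: "0 < C" using power_hardy_constant_pos[OF q] by (simp add: C_def)
  define w where "w = m powr (q - 1)"
  have w: "0 < w" using pos by (simp add: w_def)
  have wm: "m powr q = w * m"
    using pos by (simp add: w_def powr_diff)
  have ty: "box_cox q y - box_cox q m \<le> w * (y - m)"
    unfolding w_def by (rule box_cox_le_tangent) (use q pos in auto)
  have "(m / C) powr (q - 1) = w * C powr (1 - q)"
    using pos C by (simp add: w_def powr_divide powr_diff field_simps)
  also have "C powr (1 - q) = C * C powr (- q)"
    using C by (simp add: powr_diff powr_minus field_simps)
  also have "\<dots> = C * (1 - q)"
    using power_hardy_constant_powr[OF q] by (simp add: C_def)
  finally have slope: "(m / C) powr (q - 1) = w * (C * (1 - q))" .
  have "box_cox q (m / C) = m powr q * box_cox q (1 / C) + box_cox q m"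
    using box_cox_mult[of "1 / C" m q] pos C by simp
  also have "\<dots> = box_cox q m - w * m"
    using box_cox_inverse_power_hardy_constant[OF q] wm by (simp add: C_def)
  finally have "box_cox q x - (box_cox q m - w * m) \<le> w * (C * (1 - q)) * (x - m / C)"
    using box_cox_le_tangent[of q x "m / C"] q pos C slope by simp
  also have "\<dots> = w * ((1 - q) * C * x - (1 - q) * m)"
    using C by (simp add: field_simps)
  finally have tx: "box_cox q x - box_cox q m \<le> w * ((1 - q) * C * x - (1 - q) * m - m)"
    by (simp add: algebra_simps)
  have "0 = j * (box_cox q y - box_cox q m) + (box_cox q x - box_cox q m)"
    using mean by (simp add: algebra_simps)
  also have "\<dots> \<le> j * (w * (y - m)) + w * ((1 - q) * C * x - (1 - q) * m - m)"
    using mult_left_mono[OF ty j] tx by linarith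
  also have "\<dots> = w * (j * (y - m) + ((1 - q) * C * x - (1 - q) * m - m))"
    by (simp add: algebra_simps)
  finally have "0 \<le> j * (y - m) + ((1 - q) * C * x - (1 - q) * m - m)"
    using w by (simp add: zero_le_mult_iff)
  then show ?thesis by (simp add: C_def algebra_simps)
qed

section \<open>Power means\<close>

lemma sum_list_powr_pos:
  assumes "positive_tuple xs"
  shows "0 < (\<Sum>x\<leftarrow>xs. x powr q)"
proof -
  have "0 < (\<Sum>x\<leftarrow>ys. x powr q)" if "ys \<noteq> []" "\<forall>x\<in>set ys. 0 < x" for ys
    using that by (induction ys rule: list_nonempty_induct) (auto intro: add_pos_pos)
  then show ?thesis using assms by (simp add: positive_tuple_def)
qed

lemma power_mean_pos:
  assumes "positive_tuple xs"
  shows "0 < power_mean q xs"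
proof -
  have 1: "0 < prod_list ys" if "\<forall>x\<in>set ys. 0 < x" for ys :: "real list"
    using that by (induction ys) auto
  show ?thesis
    using assms 1[of xs] sum_list_powr_pos[OF assms, of q] by (auto simp: power_mean_def positive_tuple_def)
qed

lemma box_cox_power_mean:
  assumes "positive_tuple xs"
  shows "real (length xs) * box_cox q (power_mean q xs) = (\<Sum>x\<leftarrow>xs. box_cox q x)"
proof (cases "q = 0")
  case True
  have "0 < prod_list ys \<and> ln (prod_list ys) = (\<Sum>x\<leftarrow>ys. ln x)"
    if "\<forall>x\<in>set ys. 0 < x" for ys :: "real list"
    using that by (induction ys) (auto simp: ln_mult)
  then have "0 < prod_list xs" "ln (prod_list xs) = (\<Sum>x\<leftarrow>xs. ln x)"
    using assms by (auto simp: positive_tuple_def)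
  then show ?thesis
    using True assms by (simp add: box_cox_def power_mean_def ln_powr positive_tuple_def)
next
  case False
  have "(\<Sum>x\<leftarrow>ys. (x powr q - 1) / q) = ((\<Sum>x\<leftarrow>ys. x powr q) - real (length ys)) / q" for ys
    by (induction ys) (auto simp: diff_divide_distrib add_divide_distrib)
  moreover have "power_mean q xs powr q = (\<Sum>x\<leftarrow>xs. x powr q) / real (length xs)"
    using False sum_list_powr_pos[OF assms, of q] by (simp add: power_mean_def powr_powr)
  ultimately show ?thesis
    using False assms by (simp add: box_cox_def positive_tuple_def field_simps)
qed

lemma sum_list_map_upt: "(\<Sum>y\<leftarrow>map x [0..<n]. f y) = (\<Sum>k<n. f (x k))"
  for f :: "'a \<Rightarrow> 'b::comm_monoid_add"
  by (simp add: interv_sum_list_conv_sum_set_nat atLeast0LessThan comp_def)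

section \<open>The inequality of Hardy, Carleman and Knopp\<close>

lemma hardy_bound_power_mean:
  assumes q: "q < 1"
  shows "hardy_bound (power_mean q) (ennreal (power_hardy_constant q))"
  unfolding hardy_bound_def
proof (intro allI impI)
  fix x :: "nat \<Rightarrow> real"
  assume x: "\<forall>n. 0 < x n"
  define C where "C = power_hardy_constant q"
  have C: "0 < C" using power_hardy_constant_pos[OF q] by (simp add: C_def)
  define P where "P n = power_mean q (map x [0..<Suc n])" for n
  have tuple: "positive_tuple (map x [0..<Suc n])" for n
    using x by (auto simp: positive_tuple_def)
  have P: "0 < P n" for n
    unfolding P_def by (rule power_mean_pos[OF tuple])
  have S: "real (Suc n) * box_cox q (P n) = (\<Sum>k<Suc n. box_cox q (x k))" for n
    using box_cox_power_mean[OF tuple, of n q]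
    unfolding P_def sum_list_map_upt by simp
  \<comment> \<open>At \<open>n = 0\<close> there is no previous mean; \<open>P (0 - 1) = P 0\<close> takes its place with weight \<open>0\<close>.\<close>
  have step: "real (Suc n) * P n + (1 - q) * P n \<le> real n * P (n - 1) + (1 - q) * C * x n" for n
  proof -
    have "(real n + 1) * P n + (1 - q) * P n \<le> real n * P (n - 1) + (1 - q) * C * x n"
      unfolding C_def
    proof (rule hardy_step[OF q _ P P])
      have "real n * box_cox q (P (n - 1)) = (\<Sum>k<n. box_cox q (x k))"
        using S[of "n - 1"] by (cases n) auto
      then show "(real n + 1) * box_cox q (P n) = real n * box_cox q (P (n - 1)) + box_cox q (x n)"
        using S[of n] by (simp add: algebra_simps)
    qed (use x in auto)
    then show ?thesis by (simp add: algebra_simps)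
  qed
  have tele: "(1 - q) * (\<Sum>k<n. P k) + real n * P (n - 1) \<le> (1 - q) * C * (\<Sum>k<n. x k)" for n
  proof (induction n)
    case (Suc n)
    then show ?case using step[of n] by (simp add: algebra_simps)
  qed simp
  have partial: "(\<Sum>k<n. P k) \<le> C * (\<Sum>k<n. x k)" for n
  proof -
    have "0 \<le> real n * P (n - 1)" using P[of "n - 1"] by simp
    then have "(1 - q) * (\<Sum>k<n. P k) \<le> (1 - q) * (C * (\<Sum>k<n. x k))"
      using tele[of n] by (simp add: mult.assoc)
    then show ?thesis using q by simp
  qed
  have "(\<Sum>k<n. ennreal (P k)) \<le> ennreal C * (\<Sum>k. ennreal (x k))" for n
  proof -
    have "(\<Sum>k<n. ennreal (P k)) = ennreal (\<Sum>k<n. P k)"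
      using P by (intro sum_ennreal) (auto intro: less_imp_le)
    also have "\<dots> \<le> ennreal (C * (\<Sum>k<n. x k))"
      by (rule ennreal_leI[OF partial])
    also have "\<dots> = ennreal C * (\<Sum>k<n. ennreal (x k))"
      using C x by (simp add: sum_ennreal sum_nonneg ennreal_mult less_imp_le)
    also have "\<dots> \<le> ennreal C * (\<Sum>k. ennreal (x k))"
      by (intro mult_left_mono sum_le_suminf) auto
    finally show ?thesis .
  qed
  then show "(\<Sum>n. ennreal (power_mean q (map x [0..<Suc n])))
      \<le> ennreal (power_hardy_constant q) * (\<Sum>n. ennreal (x n))"
    unfolding P_def[symmetric] C_def[symmetric]
    by (intro suminf_le_const) auto
qed

section \<open>Sharpness of the constant near zero\<close>

text \<open>
  Prescribing the means \<open>a / n\<close> determines the entries: writing the \<open>(k + 1)\<close>-st entry as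
  \<open>a r / (k + 1)\<close> and dividing out the scale, the condition is
  \<open>box_cox q (r k) = - k box_cox q (1 + 1 / k)\<close>. The right-hand side lies in \<open>[- 1, 0]\<close> by
  monotonicity and concavity,
  so \<open>r k\<close> exists between \<open>1 / C q\<close> and \<open>1\<close> by the intermediate value theorem. That side tends to
  \<open>- 1\<close> because \<open>box_cox q\<close> has derivative \<open>1\<close> at \<open>1\<close>.
\<close>

lemma power_extremal_sequence:
  assumes q: "q < 1"
  obtains r :: "nat \<Rightarrow> real" where
    "\<And>k. 0 < r k" "\<And>k. r k \<le> 1"
    "\<And>a n. 0 < a \<Longrightarrow>
       (\<Sum>k<n. box_cox q (a * r k / real (Suc k))) = real n * box_cox q (a / real n)"
    "(\<lambda>k. box_cox q (r k)) \<longlonglongrightarrow> - 1"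
proof -
  define C where "C = power_hardy_constant q"
  have C: "0 < C" using power_hardy_constant_pos[OF q] by (simp add: C_def)
  have bC: "box_cox q (1 / C) = - 1"
    using box_cox_inverse_power_hardy_constant[OF q] by (simp add: C_def)
  then have C1: "1 / C \<le> 1"
    using box_cox_less_iff[of 1 "1 / C" q] C by force
  define v where "v k = - (real k * box_cox q (1 + 1 / real k))" for k :: nat
  have v: "-1 \<le> v k" "v k \<le> 0" for k
  proof -
    show "v k \<le> 0"
      using box_cox_less_iff[of 1 "1 + 1 / real k" q]
      by (cases "k = 0") (simp_all add: v_def add_pos_nonneg)
    have "box_cox q (1 + 1 / real k) \<le> 1 / real k"
      using box_cox_le_tangent[OF q, of "1 + 1 / real k" 1] by (simp add: add_pos_nonneg)
    then show "-1 \<le> v k"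
      using mult_left_mono[of "box_cox q (1 + 1 / real k)" "1 / real k" "real k"]
      by (cases "k = 0") (auto simp: v_def)
  qed
  have "\<exists>r\<ge>1 / C. r \<le> 1 \<and> box_cox q r = v k" for k
  proof (rule IVT)
    have "0 < x" if "1 / C \<le> x" for x
      using that C by (meson divide_pos_pos less_le_trans zero_less_one)
    then show "\<forall>x. 1 / C \<le> x \<and> x \<le> 1 \<longrightarrow> isCont (box_cox q) x"
      by (blast intro: isCont_box_cox)
  qed (use v C1 bC in auto)
  then obtain r where r: "\<And>k. 1 / C \<le> r k" "\<And>k. r k \<le> 1" "\<And>k. box_cox q (r k) = v k"
    by metis
  have rpos: "0 < r k" for k
    using r(1)[of k] C by (meson divide_pos_pos less_le_trans zero_less_one)
  show thesis
  proof
    show "0 < r k" "r k \<le> 1" for k using rpos r(2) by auto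
    show "(\<Sum>k<n. box_cox q (a * r k / real (Suc k))) = real n * box_cox q (a / real n)"
      if a: "0 < a" for a n
    proof (induction n)
      case (Suc n)
      define u where "u = a / real (Suc n)"
      have u: "0 < u" using a by (simp add: u_def)
      have 1: "box_cox q (a * r n / real (Suc n)) = u powr q * v n + box_cox q u"
        using box_cox_mult[OF rpos[of n] u, of q] r(3)[of n] by (simp add: u_def mult.commute)
      have 2: "real n * box_cox q (a / real n) = real n * box_cox q u - u powr q * v n"
      proof (cases "n = 0")
        case False
        then have "1 + 1 / real n = real (Suc n) / real n"
          by (simp add: add_divide_distrib)
        then have "a / real n = (1 + 1 / real n) * u"
          by (simp add: u_def del: of_nat_Suc)
        then have "box_cox q (a / real n) = u powr q * box_cox q (1 + 1 / real n) + box_cox q u"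
          using box_cox_mult[of "1 + 1 / real n" u q] u by (simp add: add_pos_nonneg)
        then show ?thesis by (simp add: v_def algebra_simps)
      qed (simp add: v_def)
      have "(\<Sum>k<Suc n. box_cox q (a * r k / real (Suc k)))
          = real n * box_cox q (a / real n) + box_cox q (a * r n / real (Suc n))"
        using Suc by (simp only: sum.lessThan_Suc)
      also have "\<dots> = real (Suc n) * box_cox q u"
        unfolding 1 2 by (simp add: algebra_simps)
      finally show ?case by (simp only: u_def)
    qed simp
    have "((\<lambda>h. (box_cox q (1 + h) - box_cox q 1) / h) \<longlongrightarrow> 1) (at 0)"
      using has_derivative_box_cox[of 1 q] by (simp add: DERIV_def)
    moreover have "filterlim (\<lambda>k. 1 / real k) (at 0) sequentially"
      unfolding filterlim_at
    proof
      show "\<forall>\<^sub>F k in sequentially. 1 / real k \<in> UNIV \<and> 1 / real k \<noteq> 0"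
        using eventually_gt_at_top[of "0::nat"] by eventually_elim simp
      show "(\<lambda>k. 1 / real k) \<longlonglongrightarrow> 0" by (rule lim_1_over_n)
    qed
    ultimately have "((\<lambda>k. (box_cox q (1 + 1 / real k) - box_cox q 1) / (1 / real k)) \<longlonglongrightarrow> 1)"
      by (rule filterlim_compose)
    then have "(\<lambda>k. - (real k * box_cox q (1 + 1 / real k))) \<longlonglongrightarrow> - 1"
      by (intro tendsto_minus) (simp add: mult.commute)
    then show "(\<lambda>k. box_cox q (r k)) \<longlonglongrightarrow> - 1"
      unfolding r(3) v_def .
  qed
qed

text \<open>
  The condition on \<open>c\<close> says that \<open>c > 1 / C q\<close>, so the conclusion for all such \<open>c\<close> amounts to
  \<open>C q \<le> d\<close>. Keeping \<open>c\<close> in this form makes the later limit in \<open>q\<close> immediate, also for the limiting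
  exponent \<open>1\<close>, which has no finite constant.

  In the proof, \<open>N\<close> entries of the extremal sequence are followed by a geometric tail, which makes
  the total finite and adds only a bounded amount. The means contribute the harmonic sum \<open>H N\<close> and the
  entries at most \<open>c H N\<close> plus a constant, both in units of \<open>a\<close>; then \<open>N\<close> tends to infinity.
\<close>

lemma hardy_bound_ge:
  assumes q: "q < 1" and b: "0 < b" and d: "0 \<le> d"
    and bound: "hardy_bound M (ennreal d)"
    and low: "\<And>xs m. \<lbrakk>xs \<noteq> []; set xs \<subseteq> {0<..<b}; m \<in> {0<..<b};
        (\<Sum>x\<leftarrow>xs. box_cox q x) = real (length xs) * box_cox q m\<rbrakk> \<Longrightarrow> m \<le> M xs"
    and c: "0 < c" "- 1 < box_cox q c"
  shows "1 \<le> d * c"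
proof -
  obtain r :: "nat \<Rightarrow> real" where rpos: "\<And>k. 0 < r k" and r1: "\<And>k. r k \<le> 1"
    and rsum: "\<And>a n. 0 < a \<Longrightarrow>
       (\<Sum>k<n. box_cox q (a * r k / real (Suc k))) = real n * box_cox q (a / real n)"
    and rlim: "(\<lambda>k. box_cox q (r k)) \<longlonglongrightarrow> - 1"
    using power_extremal_sequence[OF q] by metis
  define a where "a = b / 2"
  have a: "0 < a" "a < b" using b by (auto simp: a_def)
  define z where "z k = a * r k / real (Suc k)" for k
  have z0: "0 < z k" for k using a rpos[of k] by (simp add: z_def)
  have zb: "z k < b" for k
  proof -
    have "a * r k \<le> a * real (Suc k)"
      using a r1[of k] by (intro mult_left_mono) auto
    then have "z k \<le> a" by (simp add: z_def divide_le_eq)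
    then show ?thesis using a by simp
  qed
  define H where "H n = (\<Sum>k<n. 1 / real (Suc k))" for n
  have main: "H N \<le> d * ((\<Sum>k<N. r k / real (Suc k)) + 2)" for N
  proof -
    define x where "x k = (if k < N then z k else a * (1/2) ^ k)" for k
    define y where "y k = (if k \<in> {..<N} then z k else 0) + a * (1/2) ^ k" for k
    have x0: "0 < x k" for k using a z0 by (simp add: x_def)
    have xy: "x k \<le> y k" for k using a by (simp add: x_def y_def)
    have "(\<lambda>k::nat. a * (1/2) ^ k) sums (a * (1 / (1 - 1/2)))"
      by (intro sums_mult geometric_sums) simp
    then have "y sums ((\<Sum>k<N. z k) + 2 * a)"
      unfolding y_def
      using sums_add[OF sums_If_finite_set[of "{..<N}" z]] by (fastforce simp: mult.commute)
    then have ysum: "(\<Sum>k. ennreal (y k)) = ennreal ((\<Sum>k<N. z k) + 2 * a)"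
      using x0 xy by (intro suminf_ennreal_eq) (meson less_imp_le order_trans)
    have ineq: "a / real (Suc n) \<le> M (map x [0..<Suc n])" if "n < N" for n
    proof (rule low)
      show "set (map x [0..<Suc n]) \<subseteq> {0<..<b}"
        using that z0 zb by (auto simp: x_def)
      have "a / real (Suc n) \<le> a"
        using a by (simp add: divide_le_eq)
      then show "a / real (Suc n) \<in> {0<..<b}"
        using a by auto
      have "(\<Sum>t\<leftarrow>map x [0..<Suc n]. box_cox q t) = (\<Sum>k<Suc n. box_cox q (x k))"
        by (rule sum_list_map_upt)
      also have "\<dots> = (\<Sum>k<Suc n. box_cox q (a * r k / real (Suc k)))"
        using that by (intro sum.cong) (auto simp: x_def z_def)
      also have "\<dots> = real (Suc n) * box_cox q (a / real (Suc n))"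
        by (rule rsum[OF a(1)])
      finally show "(\<Sum>t\<leftarrow>map x [0..<Suc n]. box_cox q t)
          = real (length (map x [0..<Suc n])) * box_cox q (a / real (Suc n))"
        by simp
    qed simp
    have "ennreal (a * H N) = (\<Sum>n<N. ennreal (a / real (Suc n)))"
      using a by (subst sum_ennreal) (auto simp: H_def sum_distrib_left)
    also have "\<dots> \<le> (\<Sum>n<N. ennreal (M (map x [0..<Suc n])))"
      by (intro sum_mono ennreal_leI ineq) simp
    also have "\<dots> \<le> (\<Sum>n. ennreal (M (map x [0..<Suc n])))"
      by (intro sum_le_suminf) auto
    also have "\<dots> \<le> ennreal d * (\<Sum>k. ennreal (x k))"
      using bound x0 by (simp add: hardy_bound_def)
    also have "\<dots> \<le> ennreal d * (\<Sum>k. ennreal (y k))"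
      by (intro mult_left_mono suminf_le ennreal_leI xy) auto
    also have "\<dots> = ennreal (d * ((\<Sum>k<N. z k) + 2 * a))"
      using d a z0 by (simp add: ysum ennreal_mult add_nonneg_nonneg sum_nonneg less_imp_le)
    finally have "a * H N \<le> d * ((\<Sum>k<N. z k) + 2 * a)"
      using d a z0 by (subst (asm) ennreal_le_iff) (auto intro!: mult_nonneg_nonneg add_nonneg_nonneg sum_nonneg intro: less_imp_le)
    also have "\<dots> = a * (d * ((\<Sum>k<N. r k / real (Suc k)) + 2))"
      by (simp add: z_def sum_distrib_left algebra_simps)
    finally show ?thesis using a by simp
  qed
  have "\<forall>\<^sub>F k in sequentially. box_cox q (r k) < box_cox q c"
    using rlim c(2) by (rule order_tendstoD)
  then obtain k0 where k0: "\<And>k. k \<ge> k0 \<Longrightarrow> r k \<le> c"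
    using box_cox_less_iff[OF rpos c(1)] unfolding eventually_sequentially by (meson less_imp_le)
  have rH: "(\<Sum>k<N. r k / real (Suc k)) \<le> c * H N + real k0" for N
  proof -
    have "r k / real (Suc k) \<le> c * (1 / real (Suc k)) + (if k < k0 then 1 else 0)" for k
    proof (cases "k < k0")
      case True
      have "r k / real (Suc k) \<le> 1"
        using r1[of k] by (simp add: divide_le_eq)
      then show ?thesis using True c by (simp add: add_increasing)
    next
      case False
      then show ?thesis using k0[of k] by (simp add: divide_right_mono)
    qed
    then have "(\<Sum>k<N. r k / real (Suc k))
        \<le> (\<Sum>k<N. c * (1 / real (Suc k)) + (if k < k0 then 1 else 0))"
      by (rule sum_mono)
    also have "\<dots> = c * H N + real (card ({..<N} \<inter> {k. k < k0}))"
      by (simp add: sum.distrib H_def sum_distrib_left sum.If_cases)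
    also have "card ({..<N} \<inter> {k. k < k0}) \<le> card {..<k0}"
      by (intro card_mono) auto
    finally show ?thesis by simp
  qed
  have bdd: "(1 - d * c) * H N \<le> d * (real k0 + 2)" for N
    using main[of N] mult_left_mono[OF rH[of N] d] by (simp add: algebra_simps)
  have "filterlim H at_top sequentially"
  proof -
    have "H n = harm n" for n
      by (induction n) (auto simp: H_def harm_Suc inverse_eq_divide harm_expand)
    then have "H = harm" by blast
    then show ?thesis using harm_at_top by simp
  qed
  show ?thesis
  proof (rule ccontr)
    assume "\<not> 1 \<le> d * c"
    then have e: "0 < 1 - d * c" by simp
    have "\<forall>\<^sub>F n in sequentially. d * (real k0 + 2) / (1 - d * c) < H n"
      using \<open>filterlim H at_top sequentially\<close> by (simp add: filterlim_at_top_dense)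
    then obtain n where "d * (real k0 + 2) / (1 - d * c) < H n"
      by (auto simp: eventually_sequentially)
    with bdd[of n] e show False by (simp add: divide_less_eq mult.commute)
  qed
qed

section \<open>Comparison of quasi-arithmetic means with power means\<close>

text \<open>A negative factor reverses monotonicity, so this permits assuming that \<open>f\<close> is increasing.\<close>

lemma quasi_arithmetic_mean_scale:
  assumes "s \<noteq> 0"
  shows "quasi_arithmetic_mean (\<lambda>x. s * f x) = quasi_arithmetic_mean f"
proof
  fix xs
  have "(s * y = (\<Sum>x\<leftarrow>xs. s * f x) / real (length xs))
      \<longleftrightarrow> y = (\<Sum>x\<leftarrow>xs. f x) / real (length xs)" for y
  proof -
    have "(\<Sum>x\<leftarrow>xs. s * f x) / real (length xs) = s * ((\<Sum>x\<leftarrow>xs. f x) / real (length xs))"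
      by (simp add: sum_list_const_mult)
    then show ?thesis using assms by (simp only: mult_cancel_left) simp
  qed
  then show "quasi_arithmetic_mean (\<lambda>x. s * f x) xs = quasi_arithmetic_mean f xs"
    by (simp add: quasi_arithmetic_mean_def inv_into_def)
qed

lemma quasi_arithmetic_mean_inverse:
  assumes cont: "continuous_on {0<..} f" and xs: "positive_tuple xs"
  shows "0 < quasi_arithmetic_mean f xs"
    and "real (length xs) * f (quasi_arithmetic_mean f xs) = (\<Sum>x\<leftarrow>xs. f x)"
proof -
  let ?n = "length xs"
  have n: "0 < ?n" using xs by (simp add: positive_tuple_def)
  have "connected (f ` {0<..})"
    by (intro connected_continuous_image[OF cont] convex_connected convex_real_interval)
  then have "convex (f ` {0<..})"
    unfolding is_interval_connected_1[symmetric] is_interval_convex_1 .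
  then have "(\<Sum>i<?n. (1 / real ?n) *\<^sub>R f (xs ! i)) \<in> f ` {0<..}"
    using xs n by (intro convex_sum) (auto simp: positive_tuple_def)
  moreover have "(\<Sum>i<?n. (1 / real ?n) *\<^sub>R f (xs ! i)) = (\<Sum>x\<leftarrow>xs. f x) / real ?n"
    by (simp add: sum_list_sum_nth atLeast0LessThan sum_divide_distrib)
  ultimately have mem: "(\<Sum>x\<leftarrow>xs. f x) / real ?n \<in> f ` {0<..}" by simp
  show "0 < quasi_arithmetic_mean f xs"
    using inv_into_into[OF mem] by (simp add: quasi_arithmetic_mean_def)
  show "real ?n * f (quasi_arithmetic_mean f xs) = (\<Sum>x\<leftarrow>xs. f x)"
    using f_inv_into_f[OF mem] n by (simp add: quasi_arithmetic_mean_def)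
qed

text \<open>
  Jensen's inequality for \<open>f\<close> as a function of \<open>box_cox q\<close>: the derivative of
  \<open>h x = f' x x^(1 - q)\<close> is \<open>x^(- q) (x f'' x - (q - 1) f' x)\<close>, so the hypothesis makes \<open>h\<close>
  decreasing, and the tangents at the power mean \<open>m\<close> sum to the claim. Applied to \<open>- f\<close>, it
  gives the reverse inequality.
\<close>

lemma sum_le_at_power_mean:
  assumes S: "is_interval S" "S \<subseteq> {0<..}"
    and f: "\<And>x. x \<in> S \<Longrightarrow> (f has_real_derivative f1 x) (at x)"
    and f1: "\<And>x. x \<in> S \<Longrightarrow> (f1 has_real_derivative f2 x) (at x)"
    and le: "\<And>x. x \<in> S \<Longrightarrow> x * f2 x \<le> (q - 1) * f1 x"
    and xs: "set xs \<subseteq> S" and m: "m \<in> S"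
    and mean: "(\<Sum>x\<leftarrow>xs. box_cox q x) = real (length xs) * box_cox q m"
  shows "(\<Sum>x\<leftarrow>xs. f x) \<le> real (length xs) * f m"
proof -
  define h where "h x = f1 x * x powr (1 - q)" for x
  have pos: "0 < x" if "x \<in> S" for x using that S by auto
  have anti: "antimono_on S h"
    unfolding monotone_on_def
  proof (intro ballI impI)
    fix u v assume uv: "u \<in> S" "v \<in> S" "u \<le> v"
    show "h v \<le> h u"
    proof (rule DERIV_nonpos_imp_nonincreasing[OF uv(3)])
      fix t assume t: "u \<le> t" "t \<le> v"
      then have tS: "t \<in> S" using S uv by (meson mem_is_interval_1_I)
      have "(h has_real_derivative f2 t * t powr (1 - q) + f1 t * ((1 - q) * t powr (- q))) (at t)"
        unfolding h_def using pos[OF tS]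
        by (auto intro!: derivative_eq_intros f1[OF tS])
      moreover have "f2 t * t powr (1 - q) + f1 t * ((1 - q) * t powr (- q))
          = t powr (- q) * (t * f2 t - (q - 1) * f1 t)"
        using pos[OF tS] by (simp add: powr_diff powr_minus field_simps)
      moreover have "t powr (- q) * (t * f2 t - (q - 1) * f1 t) \<le> 0"
        using le[OF tS] by (intro mult_nonneg_nonpos) auto
      ultimately show "\<exists>y. (h has_real_derivative y) (at t) \<and> y \<le> 0" by metis
    qed
  qed
  have tangent: "f x - f m \<le> h m * (box_cox q x - box_cox q m)" if "x \<in> S" for x
  proof (rule relative_tangent[OF S(1), of f h "\<lambda>t. t powr (q - 1)"])
    show "(f has_real_derivative h t * t powr (q - 1)) (at t)" if "t \<in> S" for t
      using f[OF that] pos[OF that] by (simp add: h_def mult.assoc flip: powr_add)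
  qed (use anti that m pos has_derivative_box_cox in auto)
  have "(\<Sum>x\<leftarrow>xs. f x) - real (length xs) * f m
      \<le> h m * ((\<Sum>x\<leftarrow>xs. box_cox q x) - real (length xs) * box_cox q m)"
    using xs
  proof (induction xs)
    case (Cons x xs)
    then show ?case using tangent[of x] by (simp add: algebra_simps)
  qed simp
  then show ?thesis using mean by simp
qed

section \<open>The function kappa\<close>

text \<open>
  A convex function with \<open>g (0+) \<le> 0\<close> lies below the chord from the origin, that is,
  \<open>y g x \<le> x g y\<close> for \<open>x \<le> y\<close>. As \<open>g\<close> is not defined at \<open>0\<close>, chords start at a small \<open>e > 0\<close>
  instead, and \<open>e\<close> tends to \<open>0\<close>.
\<close>

lemma antimono_divide_negative_convex:
  fixes g :: "real \<Rightarrow> real"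
  assumes conv: "convex_on {0<..} g" and neg: "\<And>x. 0 < x \<Longrightarrow> g x < 0"
  shows "antimono_on {0<..} (\<lambda>x. x / g x)"
  unfolding monotone_on_def
proof (intro ballI impI)
  fix x y :: real assume "x \<in> {0<..}" "y \<in> {0<..}" "x \<le> y"
  then have xy: "0 < x" "0 < y" "x \<le> y" by auto
  show "y / g y \<le> x / g x"
  proof (cases "x = y")
    case False
    then have "x < y" using xy by simp
    have "(y - e) * g x \<le> (x - e) * g y" if e: "0 < e" "e < x" for e
    proof -
      have "g x \<le> (g y - g e) / (y - e) * (x - e) + g e"
        using convex_onD_Icc'[of e y g x] convex_on_subset[OF conv, of "{e..y}"] e \<open>x < y\<close>
        by (auto simp: subset_iff)
      then have "(y - e) * g x \<le> (y - x) * g e + (x - e) * g y"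
        using e \<open>x < y\<close> by (simp add: field_simps)
      moreover have "(y - x) * g e \<le> 0"
        using neg[of e] e \<open>x < y\<close> by (simp add: mult_nonneg_nonpos less_imp_le)
      ultimately show ?thesis by simp
    qed
    then have "\<forall>\<^sub>F e in at_right 0. (y - e) * g x \<le> (x - e) * g y"
      using xy by (auto simp: eventually_at_right_field)
    moreover have "((\<lambda>e. (y - e) * g x) \<longlongrightarrow> (y - 0) * g x) (at_right 0)"
      "((\<lambda>e. (x - e) * g y) \<longlongrightarrow> (x - 0) * g y) (at_right 0)"
      by (intro tendsto_intros)+
    ultimately have "(y - 0) * g x \<le> (x - 0) * g y"
      by (intro tendsto_le[of "at_right (0::real)" "\<lambda>e. (x - e) * g y" _ "\<lambda>e. (y - e) * g x"]) auto
    then show ?thesis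
      using neg[of x] neg[of y] xy by (simp add: divide_le_eq le_divide_eq mult.commute)
  qed simp
qed

lemma antimono_on_tendsto_at_right_0:
  fixes k :: "real \<Rightarrow> real"
  assumes anti: "antimono_on {0<..} k" and le: "\<And>x. 0 < x \<Longrightarrow> k x \<le> B"
  obtains p where "(k \<longlongrightarrow> p) (at_right 0)" "\<And>x. 0 < x \<Longrightarrow> k x \<le> p" "p \<le> B"
proof
  define p where "p = Sup (k ` {0<..})"
  have bdd: "bdd_above (k ` {0<..})" using le by (auto intro!: bdd_aboveI2)
  show kp: "k x \<le> p" if "0 < x" for x
    unfolding p_def using bdd that by (auto intro: cSUP_upper)
  show "p \<le> B"
    unfolding p_def by (rule cSUP_least) (use le in \<open>auto intro: exI[of _ 1]\<close>)
  show "(k \<longlongrightarrow> p) (at_right 0)"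
  proof (rule order_tendstoI)
    fix a assume "a < p"
    then obtain x0 where "0 < x0" "a < k x0"
      unfolding p_def using less_cSUP_iff[OF _ bdd, of a] gt_ex[of "0::real"] by auto
    moreover have "k x0 \<le> k x" if "0 < x" "x < x0" for x
      using anti that by (auto simp: monotone_on_def)
    ultimately show "\<forall>\<^sub>F x in at_right 0. a < k x"
      by (auto simp: eventually_at_right_field intro!: exI[of _ x0] intro: less_le_trans)
  next
    fix a assume "p < a"
    then show "\<forall>\<^sub>F x in at_right 0. k x < a"
      using kp by (auto simp: eventually_at_right_field intro!: exI[of _ 1] intro: le_less_trans)
  qed
qed

section \<open>The equivalence and the Hardy constant\<close>

theorem theorem3p3:
  fixes f :: "real \<Rightarrow> real"
  assumes diff1: "\<And>x. 0 < x \<Longrightarrow> f differentiable (at x)"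
    and diff2: "\<And>x. 0 < x \<Longrightarrow> deriv f differentiable (at x)"
    and cont2: "continuous_on {0<..} (deriv (deriv f))"
    and nz1: "\<And>x. 0 < x \<Longrightarrow> deriv f x \<noteq> 0"
    and nz2: "\<And>x. 0 < x \<Longrightarrow> deriv (deriv f) x \<noteq> 0"
    and conv: "convex_on {0<..} (\<lambda>x. deriv f x / deriv (deriv f) x)"
    and neg: "\<And>x. 0 < x \<Longrightarrow> deriv f x / deriv (deriv f) x < 0"
  shows "antimono_on {0<..} (kappa f) \<and>
    (\<exists>p :: real. (kappa f \<longlongrightarrow> p) (at_right 0) \<and>
      (hardy_mean (quasi_arithmetic_mean f) \<longleftrightarrow>
        (\<exists>q<1. mean_le (quasi_arithmetic_mean f) (power_mean q))) \<and>
      ((\<exists>q<1. mean_le (quasi_arithmetic_mean f) (power_mean q)) \<longleftrightarrow> p < 1) \<and>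
      (hardy_mean (quasi_arithmetic_mean f) \<or>
       (\<exists>q<1. mean_le (quasi_arithmetic_mean f) (power_mean q)) \<or>
       p < 1 \<longrightarrow>
        mean_le (quasi_arithmetic_mean f) (power_mean p) \<and>
        hardy_constant (quasi_arithmetic_mean f) = hardy_C (ereal p)))"
proof -
  define f1 f2 where "f1 = deriv f" and "f2 = deriv f1"
  have df: "(f has_real_derivative f1 x) (at x)" if "0 < x" for x
    using diff1[OF that] by (simp add: f1_def DERIV_deriv_iff_real_differentiable)
  have df1: "(f1 has_real_derivative f2 x) (at x)" if "0 < x" for x
    using diff2[OF that] by (simp add: f1_def f2_def DERIV_deriv_iff_real_differentiable)
  have cont: "continuous_on {0<..} f" and cont1: "continuous_on {0<..} f1"
    by (auto intro!: continuous_at_imp_continuous_on DERIV_isCont df df1)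
  have kappa: "kappa f x = x / (f1 x / f2 x) + 1" for x
    by (simp add: kappa_def f1_def f2_def)
  have anti: "antimono_on {0<..} (kappa f)"
    using antimono_divide_negative_convex[OF conv neg]
    by (simp add: kappa f1_def f2_def monotone_on_def)
  have "kappa f x \<le> 1" if "0 < x" for x
    using neg[OF that] that divide_nonneg_neg[of x "f1 x / f2 x"]
    unfolding kappa f1_def[symmetric] f2_def[symmetric] by linarith
  then obtain p where lim: "(kappa f \<longlongrightarrow> p) (at_right 0)"
    and kp: "\<And>x. 0 < x \<Longrightarrow> kappa f x \<le> p" and p1: "p \<le> 1"
    using antimono_on_tendsto_at_right_0[OF anti] by blast

  \<comment> \<open>By continuity \<open>f'\<close> has constant sign, and multiplication by \<open>f' 1\<close> makes it positive.\<close>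
  obtain s where s: "s \<noteq> 0" "\<And>x. 0 < x \<Longrightarrow> 0 < s * f1 x"
  proof
    have "is_interval (f1 ` {0<..})"
      unfolding is_interval_connected_1
      by (intro connected_continuous_image[OF cont1] convex_connected convex_real_interval)
    moreover have "0 \<notin> f1 ` {0<..}" using nz1 by (auto simp: f1_def)
    ultimately have no: False if "0 < x" "0 < y" "f1 x \<le> 0" "0 \<le> f1 y" for x y
      using mem_is_interval_1_I[of "f1 ` {0<..}" "f1 x" "f1 y" 0] that by auto
    show "f1 1 \<noteq> 0" using nz1[of 1] by (simp add: f1_def)
    show "0 < f1 1 * f1 x" if "0 < x" for x
      using no[of x 1] no[of 1 x] that by (force simp: zero_less_mult_iff)
  qed
  define F where "F x = s * f x" for x
  have dF: "(F has_real_derivative s * f1 x) (at x)" if "0 < x" for x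
    unfolding F_def using DERIV_cmult[OF df[OF that]] .
  have dF1: "((\<lambda>x. s * f1 x) has_real_derivative s * f2 x) (at x)" if "0 < x" for x
    using DERIV_cmult[OF df1[OF that]] .
  have F_mono: "F x < F y" if "0 < x" "x < y" for x y
  proof (rule DERIV_pos_imp_increasing[OF that(2)])
    fix t assume "x \<le> t" "t \<le> y"
    then show "\<exists>D. (F has_real_derivative D) (at t) \<and> 0 < D"
      using dF[of t] s(2)[of t] that by auto
  qed
  have F_le: "x \<le> y" if "0 < x" "0 < y" "F x \<le> F y" for x y
    using F_mono[of y x] that by force
  have kF: "x * (s * f2 x) = (kappa f x - 1) * (s * f1 x)" if "0 < x" for x
    using s(2)[OF that] by (auto simp: kappa field_simps)

  let ?A = "quasi_arithmetic_mean f"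
  have AF: "?A = quasi_arithmetic_mean F"
    unfolding F_def using quasi_arithmetic_mean_scale[OF s(1)] by simp
  have contF: "continuous_on {0<..} F"
    unfolding F_def by (intro continuous_intros cont)
  note A = quasi_arithmetic_mean_inverse[OF contF, folded AF]

  have upper: "mean_le ?A (power_mean p)"
    unfolding mean_le_def
  proof (intro allI impI)
    fix xs assume xs: "positive_tuple xs"
    let ?m = "power_mean p xs"
    have m: "0 < ?m" using power_mean_pos[OF xs] .
    have n: "0 < length xs" using xs by (simp add: positive_tuple_def)
    have "(\<Sum>x\<leftarrow>xs. F x) \<le> real (length xs) * F ?m"
    proof (rule sum_le_at_power_mean[of "{0<..}" F "\<lambda>x. s * f1 x" "\<lambda>x. s * f2 x" p])
      show "x * (s * f2 x) \<le> (p - 1) * (s * f1 x)" if "x \<in> {0<..}" for x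
        using that kp[of x] s(2)[of x] by (simp add: kF mult_right_mono)
    qed (use xs m dF dF1 box_cox_power_mean[OF xs] in \<open>auto simp: is_interval_def positive_tuple_def\<close>)
    then have "F (?A xs) \<le> F ?m"
      using A(2)[OF xs] n by (metis mult_le_cancel_left_pos of_nat_0_less_iff)
    then show "?A xs \<le> ?m" using F_le[OF A(1)[OF xs] m] by simp
  qed

  have lower: "1 \<le> d * c"
    if d: "0 \<le> d" "hardy_bound ?A (ennreal d)" and c: "0 < c" "- 1 < box_cox p c" for c d
  proof -
    have "\<forall>\<^sub>F q in at_left p. - 1 < box_cox q c"
      using tendsto_box_cox_exponent[OF c(1), of p] c(2) by (rule order_tendstoD)
    moreover have "\<forall>\<^sub>F q in at_left p. q < p"
      by (simp add: eventually_at_filter)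
    ultimately have "\<forall>\<^sub>F q in at_left p. q < p \<and> - 1 < box_cox q c"
      by eventually_elim simp
    then obtain q where q: "q < p" "- 1 < box_cox q c"
      using eventually_happens'[OF trivial_limit_at_left_real] by blast
    have "\<forall>\<^sub>F x in at_right 0. q < kappa f x"
      using lim q(1) by (rule order_tendstoD)
    then obtain b where b: "0 < b" "\<And>x. 0 < x \<Longrightarrow> x < b \<Longrightarrow> q < kappa f x"
      by (auto simp: eventually_at_right_field)
    show ?thesis
    proof (rule hardy_bound_ge[OF _ b(1) d _ c(1) q(2)])
      show "q < 1" using q p1 by simp
      fix xs m
      assume xs: "xs \<noteq> []" "set xs \<subseteq> {0<..<b}" and m: "m \<in> {0<..<b}"
        and mean: "(\<Sum>x\<leftarrow>xs. box_cox q x) = real (length xs) * box_cox q m"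
      have tuple: "positive_tuple xs" using xs by (auto simp: positive_tuple_def)
      have "(\<Sum>x\<leftarrow>xs. - F x) \<le> real (length xs) * (- F m)"
      proof (rule sum_le_at_power_mean[of "{0<..<b}" "\<lambda>x. - F x" "\<lambda>x. - (s * f1 x)" "\<lambda>x. - (s * f2 x)" q])
        show "x * - (s * f2 x) \<le> (q - 1) * - (s * f1 x)" if "x \<in> {0<..<b}" for x
          using that b(2)[of x] s(2)[of x] by (simp add: kF mult_right_mono)
      qed (use xs m mean in \<open>auto simp: is_interval_def intro!: DERIV_minus dF dF1\<close>)
      then have "real (length xs) * F m \<le> real (length xs) * F (?A xs)"
        using A(2)[OF tuple] by (simp add: uminus_sum_list_map[unfolded comp_def, symmetric])
      then have "F m \<le> F (?A xs)" using xs by simp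
      then show "m \<le> ?A xs" using F_le[OF _ A(1)[OF tuple]] m by simp
    qed
  qed

  have bound_from_power_mean: "hardy_bound ?A (ennreal (power_hardy_constant q))"
    if "mean_le ?A (power_mean q)" "q < 1" for q
    unfolding hardy_bound_def
  proof (intro allI impI)
    fix x :: "nat \<Rightarrow> real" assume x: "\<forall>n. 0 < x n"
    have "(\<Sum>n. ennreal (?A (map x [0..<Suc n]))) \<le> (\<Sum>n. ennreal (power_mean q (map x [0..<Suc n])))"
      using that(1) x by (intro suminf_le ennreal_leI) (auto simp: mean_le_def positive_tuple_def)
    also have "\<dots> \<le> ennreal (power_hardy_constant q) * (\<Sum>n. ennreal (x n))"
      using hardy_bound_power_mean[OF that(2)] x by (simp add: hardy_bound_def)
    finally show "(\<Sum>n. ennreal (?A (map x [0..<Suc n])))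
      \<le> ennreal (power_hardy_constant q) * (\<Sum>n. ennreal (x n))" .
  qed

  have ii_i: "hardy_mean ?A" if "\<exists>q<1. mean_le ?A (power_mean q)"
  proof -
    from that obtain q where "q < 1" "mean_le ?A (power_mean q)" by auto
    then have "hardy_constant ?A \<le> ennreal (power_hardy_constant q)"
      unfolding hardy_constant_def by (intro Inf_lower) (simp add: bound_from_power_mean)
    then show ?thesis
      unfolding hardy_mean_def by (auto intro: le_less_trans)
  qed
  have i_iii: "p < 1" if hardy: "hardy_mean ?A"
  proof (rule ccontr)
    assume "\<not> p < 1"
    then have "p = 1" using p1 by simp
    from hardy obtain D where D: "hardy_bound ?A D" "D < \<infinity>"
      unfolding hardy_mean_def hardy_constant_def Inf_less_iff by auto
    then obtain d where d: "0 \<le> d" "D = ennreal d" by (cases D) auto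
    \<comment> \<open>\<open>box_cox 1 c = c - 1\<close> exceeds \<open>- 1\<close> for every \<open>c > 0\<close>; this choice gives \<open>d c < 1\<close>.\<close>
    have "1 \<le> d * (1 / (d + 1))"
      by (rule lower) (use d D \<open>p = 1\<close> in \<open>auto simp: box_cox_def field_simps\<close>)
    then show False using d by (simp add: field_simps)
  qed
  have const: "hardy_constant ?A = hardy_C (ereal p)" if p: "p < 1"
  proof -
    let ?C = "power_hardy_constant p"
    have C: "0 < ?C" using power_hardy_constant_pos[OF p] .
    have "ennreal ?C \<le> D" if D: "hardy_bound ?A D" for D
    proof (cases D)
      case (real d)
      have "?C \<le> d"
      proof (rule ccontr)
        assume "\<not> ?C \<le> d"
        then have dC: "d < ?C" by simp
        \<comment> \<open>\<open>1 / c\<close> is the midpoint of \<open>d\<close> and \<open>C p\<close>.\<close>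
        define c where "c = 2 / (?C + d)"
        have c: "0 < c" "1 / ?C < c" "d * c < 1"
          using dC C real by (auto simp: c_def field_simps)
        have "- 1 < box_cox p c"
          using box_cox_strict_mono[OF _ c(2), of p] C
            box_cox_inverse_power_hardy_constant[OF p] by simp
        then show False
          using lower[of d c] real D c by auto
      qed
      then show ?thesis using real by (simp add: ennreal_leI)
    qed simp
    then have "ennreal ?C \<le> hardy_constant ?A"
      unfolding hardy_constant_def by (intro Inf_greatest) simp
    moreover have "hardy_constant ?A \<le> ennreal ?C"
      unfolding hardy_constant_def by (intro Inf_lower) (simp add: bound_from_power_mean[OF upper p])
    ultimately show ?thesis by (simp add: hardy_C_eq[OF p])
  qed
  have "antimono_on {0<..} (kappa f) \<and> (kappa f \<longlongrightarrow> p) (at_right 0)"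
    using anti lim by simp
  then show ?thesis
    using upper ii_i i_iii const by blast
qed

end
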